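(* Let $R\in\{\mathbb R,\mathbb C\}$ with the Euclidean topology and let $X$ be a non-trivial semitopological linear space over the topological field $R$. Then the Bohr modification $X^{\flat}$ is not a topological linear space over $R$, and for any element $x\in X$ the map $R\to X^{\flat}$, $\lambda\mapsto\lambda\cdot x$, is not a topological embedding.
   Context: A semitopological (resp. topological) linear space over a topological field $F$ is a linear space $X$ over $F$ endowed with a Hausdorff topology turning $X$ into an Abelian topological group and making the multiplication $F\times X\to X$, $(\lambda,x)\mapsto\lambda\cdot x$, separately (resp. jointly) continuous. Non-trivial means $X\neq\{0\}$. The Bohr topology on a topological group $X$ is the smallest topology $\tau$ on $X$ such that every continuous homomorphism from $X$ (with its original topology) to a Hausdorff compact topological group remains continuous with respect to $\tau$. The group $X$ endowed with its Bohr topology is denoted $X^{\flat}$ and called the Bohr modification of $X$ (for a linear space $X$, with the same linear structure). *)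

theory Defs
  imports "HOL-Analysis.Analysis" "HOL-Algebra.Group"
begin

no_notation eq_closure_of ("closure'_of\<index>")

class topological_field = field + topological_ab_group_add + topological_semigroup_mult +
  assumes tendsto_inverse_nhds: "a \<noteq> 0 \<Longrightarrow> (inverse \<longlongrightarrow> inverse a) (nhds a)"

instance real :: topological_field
proof
  fix a :: real
  assume "a \<noteq> 0"
  show "(inverse \<longlongrightarrow> inverse a) (nhds a)"
    by (rule tendsto_inverse[OF filterlim_ident \<open>a \<noteq> 0\<close>])
qed

instance complex :: topological_field
proof
  fix a :: complex
  assume "a \<noteq> 0"
  show "(inverse \<longlongrightarrow> inverse a) (nhds a)"
    by (rule tendsto_inverse[OF filterlim_ident \<open>a \<noteq> 0\<close>])
qed

definition topological_group :: "('g, 'm) monoid_scheme \<Rightarrow> 'g topology \<Rightarrow> bool" where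
  "topological_group G T \<longleftrightarrow>
     group G \<and> topspace T = carrier G \<and>
     continuous_map (prod_topology T T) T (\<lambda>(x, y). x \<otimes>\<^bsub>G\<^esub> y) \<and>
     continuous_map T T (\<lambda>x. inv\<^bsub>G\<^esub> x)"

definition additive_group :: "'a::ab_group_add monoid" where
  "additive_group = \<lparr>carrier = UNIV, mult = (+), one = 0\<rparr>"

lemma comm_group_additive_group: "comm_group (additive_group :: 'a::ab_group_add monoid)"
proof (rule comm_groupI)
  fix x :: 'a
  show "\<exists>y\<in>carrier additive_group. y \<otimes>\<^bsub>additive_group\<^esub> x = \<one>\<^bsub>additive_group\<^esub>"
    by (rule bexI[of _ "- x"]) (simp_all add: additive_group_def)
qed (auto simp: additive_group_def add.assoc add.commute)

text \<open>The linear space is a whole type carrying an additive group structure and a scalar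
  multiplication; its topology is a separate parameter, because the same linear space is
  considered with two topologies. The scalar field carries the topology of its type class.\<close>

definition semitopological_linear_space ::
    "('f::topological_field \<Rightarrow> 'a::ab_group_add \<Rightarrow> 'a) \<Rightarrow> 'a topology \<Rightarrow> bool" where
  "semitopological_linear_space smul T \<longleftrightarrow>
     vector_space smul \<and> Hausdorff_space T \<and> topological_group additive_group T \<and>
     (\<forall>c. continuous_map T T (\<lambda>x. smul c x)) \<and>
     (\<forall>x. continuous_map euclidean T (\<lambda>c. smul c x))"

definition topological_linear_space ::
    "('f::topological_field \<Rightarrow> 'a::ab_group_add \<Rightarrow> 'a) \<Rightarrow> 'a topology \<Rightarrow> bool" where
  "topological_linear_space smul T \<longleftrightarrow>
     vector_space smul \<and> Hausdorff_space T \<and> topological_group additive_group T \<and>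
     continuous_map (prod_topology euclidean T) T (\<lambda>(c, x). smul c x)"

text \<open>The Bohr topology is generated by the preimages of open sets under all continuous
  homomorphisms \<open>h\<close> to compact Hausdorff groups \<open>K\<close>. A definition cannot quantify over the type of
  the elements of \<open>K\<close>, so \<open>K\<close> ranges over the groups whose carrier is a subset of the type
  \<open>'a set set\<close>. This is no restriction: \<open>h\<close> may be regarded as a map to the closure of its image,
  and a Hausdorff space with a dense image of \<open>'a\<close> embeds into \<open>'a set set\<close> as a set. The
  lemmas below show that the resulting topology is the smallest one making all continuous
  homomorphisms to compact Hausdorff groups, over arbitrary types, continuous.\<close>

definition bohr_topology :: "('a, 'm) monoid_scheme \<Rightarrow> 'a topology \<Rightarrow> 'a topology" where
  "bohr_topology G T = topology_generated_by
     {{x \<in> carrier G. h x \<in> U} | h U. \<exists>(K :: 'a set set monoid) S.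
        topological_group K S \<and> compact_space S \<and> Hausdorff_space S \<and>
        h \<in> hom G K \<and> continuous_map T S h \<and> openin S U}"

lemma bohr_topology_basic:
  fixes G :: "('a, 'm) monoid_scheme" and K :: "'a set set monoid"
  assumes "topological_group K S" "compact_space S" "Hausdorff_space S"
    and "h \<in> hom G K" "continuous_map T S h" "openin S U"
  shows "openin (bohr_topology G T) {x \<in> carrier G. h x \<in> U}"
  unfolding bohr_topology_def by (rule topology_generated_by_Basis) (use assms in blast)

lemma topspace_bohr_topology:
  fixes G :: "('a, 'm) monoid_scheme"
  assumes "topological_group G T"
  shows "topspace (bohr_topology G T) = carrier G"
proof
  show "topspace (bohr_topology G T) \<subseteq> carrier G"
    unfolding bohr_topology_def topology_generated_by_topspace by blast
next
  define K :: "'a set set monoid" where "K = \<lparr>carrier = {{}}, mult = (\<lambda>_ _. {}), one = {}\<rparr>"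
  define S :: "'a set set topology" where "S = discrete_topology {{}}"
  have gK: "group K"
    by (rule groupI) (auto simp: K_def)
  have inv: "inv\<^bsub>K\<^esub> x \<in> {{}}" if "x = {}" for x
    using group.inv_closed[OF gK, of x] that by (simp add: K_def)
  have "topological_group K S"
    unfolding topological_group_def
    using gK inv
    by (simp add: S_def K_def case_prod_unfold continuous_map_from_discrete_topology Pi_iff
        flip: prod_topology_discrete_topology)
  moreover have "compact_space S"
    by (simp add: S_def compact_space_discrete_topology)
  moreover have "Hausdorff_space S"
    by (simp add: S_def)
  moreover have "(\<lambda>_. {}) \<in> hom G K"
    by (simp add: hom_def K_def)
  moreover have "continuous_map T S (\<lambda>_. {})"
    by (simp add: S_def)
  moreover have "openin S {{}}"
    by (simp add: S_def)
  ultimately have "openin (bohr_topology G T) {x \<in> carrier G. {} \<in> {{} :: 'a set set}}"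
    by (rule bohr_topology_basic[where h = "\<lambda>_. {}"])
  then show "carrier G \<subseteq> topspace (bohr_topology G T)"
    using openin_subset by fastforce
qed

lemma closure_of_hom_image_subgroup:
  assumes K: "topological_group K S" and G: "group G" and h: "h \<in> hom G K"
  shows "subgroup (S closure_of (h ` carrier G)) K"
proof -
  interpret G: group G by fact
  interpret K: group K using K by (simp add: topological_group_def)
  interpret h: group_hom G K h
    using h by (unfold_locales) auto
  let ?H = "h ` carrier G" and ?C = "S closure_of (h ` carrier G)"
  have top: "topspace S = carrier K" using K by (simp add: topological_group_def)
  have HC: "?H \<subseteq> ?C"
    by (rule closure_of_subset) (auto simp: top)
  have sub: "subgroup ?H K"
    by (rule h.img_is_subgroup)
  have cm: "continuous_map (prod_topology S S) S (\<lambda>(x, y). x \<otimes>\<^bsub>K\<^esub> y)"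
    and ci: "continuous_map S S (\<lambda>x. inv\<^bsub>K\<^esub> x)"
    using K by (auto simp: topological_group_def)
  show ?thesis
  proof (rule K.subgroupI)
    show "?C \<subseteq> carrier K"
      using closure_of_subset_topspace[of S ?H] by (simp add: top)
    show "?C \<noteq> {}"
      using HC G.one_closed by blast
    show "inv\<^bsub>K\<^esub> a \<in> ?C" if "a \<in> ?C" for a
    proof -
      have "(\<lambda>x. inv\<^bsub>K\<^esub> x) ` ?C \<subseteq> S closure_of ((\<lambda>x. inv\<^bsub>K\<^esub> x) ` ?H)"
        by (rule continuous_map_image_closure_subset[OF ci])
      also have "\<dots> \<subseteq> ?C"
        by (rule closure_of_mono) (use subgroup.m_inv_closed[OF sub] in blast)
      finally show ?thesis using that by blast
    qed
    show "a \<otimes>\<^bsub>K\<^esub> b \<in> ?C" if "a \<in> ?C" "b \<in> ?C" for a b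
    proof -
      have "(\<lambda>(x, y). x \<otimes>\<^bsub>K\<^esub> y) ` (prod_topology S S closure_of (?H \<times> ?H))
          \<subseteq> S closure_of ((\<lambda>(x, y). x \<otimes>\<^bsub>K\<^esub> y) ` (?H \<times> ?H))"
        by (rule continuous_map_image_closure_subset[OF cm])
      also have "\<dots> \<subseteq> ?C"
        by (rule closure_of_mono) (auto intro!: subgroup.m_closed[OF sub])
      finally have "(\<lambda>(x, y). x \<otimes>\<^bsub>K\<^esub> y) ` (?C \<times> ?C) \<subseteq> ?C"
        by (simp add: closure_of_Times)
      then have "(\<lambda>(x, y). x \<otimes>\<^bsub>K\<^esub> y) (a, b) \<in> ?C"
        using that by blast
      then show ?thesis by simp
    qed
  qed
qed

lemma topological_group_transport:
  fixes K :: "('k, 'm) monoid_scheme" and e :: "'k \<Rightarrow> 'b"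
  assumes K: "topological_group K S" and C: "subgroup C K" and e: "inj_on e C"
  defines "g \<equiv> inv_into C e"
  defines "K' \<equiv> \<lparr>carrier = e ` C, mult = (\<lambda>a b. e (g a \<otimes>\<^bsub>K\<^esub> g b)), one = e \<one>\<^bsub>K\<^esub>\<rparr>"
  defines "S' \<equiv> pullback_topology (e ` C) g S"
  shows "topological_group K' S'"
    and "homeomorphic_maps (subtopology S C) S' e g"
proof -
  interpret K: group K using K by (simp add: topological_group_def)
  interpret C: subgroup C K by fact
  have top: "topspace S = carrier K" using K by (simp add: topological_group_def)
  have ge: "g (e x) = x" if "x \<in> C" for x
    using that e by (simp add: g_def)
  have gC: "g a \<in> C" if "a \<in> e ` C" for a
    using that ge by auto
  have eg: "e (g a) = a" if "a \<in> e ` C" for a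
    using that ge by auto
  have topS': "topspace S' = e ` C"
    using gC C.subset by (auto simp: S'_def topspace_pullback_topology top)
  have gr: "group K'"
  proof (rule groupI)
    show "\<exists>y\<in>carrier K'. y \<otimes>\<^bsub>K'\<^esub> x = \<one>\<^bsub>K'\<^esub>" if "x \<in> carrier K'" for x
    proof (rule bexI[of _ "e (inv\<^bsub>K\<^esub> g x)"])
      show "e (inv\<^bsub>K\<^esub> g x) \<otimes>\<^bsub>K'\<^esub> x = \<one>\<^bsub>K'\<^esub>"
        using that gC[of x] by (simp add: K'_def ge)
      show "e (inv\<^bsub>K\<^esub> g x) \<in> carrier K'"
        using that gC[of x] by (simp add: K'_def)
    qed
  qed (auto simp: K'_def ge K.m_assoc)
  have inv': "inv\<^bsub>K'\<^esub> a = e (inv\<^bsub>K\<^esub> g a)" if "a \<in> e ` C" for a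
  proof (rule group.inv_equality[OF gr])
    show "e (inv\<^bsub>K\<^esub> g a) \<otimes>\<^bsub>K'\<^esub> a = \<one>\<^bsub>K'\<^esub>"
      using that gC[of a] by (simp add: K'_def ge)
  qed (use that gC[of a] in \<open>simp_all add: K'_def\<close>)
  have gcont: "continuous_map S' S g"
    using continuous_map_pullback[OF continuous_map_id, of "e ` C" g S]
    by (simp add: S'_def)
  have cm: "continuous_map (prod_topology S S) S (\<lambda>(x, y). x \<otimes>\<^bsub>K\<^esub> y)"
    and ci: "continuous_map S S (\<lambda>x. inv\<^bsub>K\<^esub> x)"
    using K by (auto simp: topological_group_def)
  have into: "continuous_map Y S' f"
    if "continuous_map Y S (g \<circ> f)" "\<And>y. y \<in> topspace Y \<Longrightarrow> f y \<in> e ` C" for Y :: "'y topology" and f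
    unfolding S'_def by (rule continuous_map_pullback') (use that in auto)
  have mult': "continuous_map (prod_topology S' S') S' (\<lambda>(x, y). x \<otimes>\<^bsub>K'\<^esub> y)"
  proof (rule into)
    have "continuous_map (prod_topology S' S') S ((\<lambda>(x, y). x \<otimes>\<^bsub>K\<^esub> y) \<circ> (\<lambda>(x, y). (g x, g y)))"
      by (rule continuous_map_compose[OF _ cm])
        (simp add: gcont continuous_map_prod_top)
    then show "continuous_map (prod_topology S' S') S (g \<circ> (\<lambda>(x, y). x \<otimes>\<^bsub>K'\<^esub> y))"
      by (rule continuous_map_eq) (auto simp: topS' K'_def ge)
  qed (auto simp: topS' K'_def ge)
  have "continuous_map S' S' (\<lambda>x. inv\<^bsub>K'\<^esub> x)"
  proof (rule into)
    have "continuous_map S' S ((\<lambda>x. inv\<^bsub>K\<^esub> x) \<circ> g)"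
      by (rule continuous_map_compose[OF gcont ci])
    then show "continuous_map S' S (g \<circ> (\<lambda>x. inv\<^bsub>K'\<^esub> x))"
      by (rule continuous_map_eq) (auto simp: topS' inv' ge)
  qed (auto simp: topS' inv' ge)
  then show "topological_group K' S'"
    using gr mult' topS' by (simp add: topological_group_def K'_def)
  have "continuous_map (subtopology S C) S' e"
  proof (rule into)
    have "continuous_map (subtopology S C) S id"
      using continuous_map_from_subtopology continuous_map_id by blast
    then show "continuous_map (subtopology S C) S (g \<circ> e)"
      by (rule continuous_map_eq) (auto simp: ge)
  qed auto
  moreover have "continuous_map S' (subtopology S C) g"
    using gcont gC by (auto simp: continuous_map_in_subtopology topS')
  ultimately show "homeomorphic_maps (subtopology S C) S' e g"
    by (auto simp: homeomorphic_maps_def topS' ge eg)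
qed

theorem bohr_topology_continuous_hom:
  fixes G :: "('a, 'm) monoid_scheme" and K :: "('k, 'n) monoid_scheme"
  assumes G: "topological_group G T"
    and K: "topological_group K S" "compact_space S" "Hausdorff_space S"
    and h: "h \<in> hom G K" "continuous_map T S h"
  shows "continuous_map (bohr_topology G T) S h"
proof -
  have grG: "group G" using G by (simp add: topological_group_def)
  interpret K: group K using K by (simp add: topological_group_def)
  have top: "topspace S = carrier K" using K by (simp add: topological_group_def)
  define C where "C = S closure_of (h ` carrier G)"
  have C: "subgroup C K"
    unfolding C_def by (rule closure_of_hom_image_subgroup[OF K(1) grG h(1)])
  have hK: "h x \<in> carrier K" if "x \<in> carrier G" for x
    using that h(1) by (auto simp: hom_def)
  have hC: "h x \<in> C" if "x \<in> carrier G" for x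
    using closure_of_subset[of "h ` carrier G" S] that hK by (auto simp: C_def top)
  define e where "e k = {A. A \<subseteq> carrier G \<and> k \<in> S closure_of (h ` A)}" for k
  have e: "inj_on e C"
  proof (rule inj_onI, rule ccontr)
    fix k l assume kl: "k \<in> C" "l \<in> C" "e k = e l" "k \<noteq> l"
    have "k \<in> topspace S" "l \<in> topspace S"
      using kl by (auto simp: C_def in_closure_of)
    then obtain U V where UV: "openin S U" "openin S V" "k \<in> U" "l \<in> V" "disjnt U V"
      using K(3) kl(4) unfolding Hausdorff_space_def by blast
    define A where "A = {x \<in> carrier G. h x \<in> U}"
    have "k \<in> S closure_of (h ` A)"
      unfolding in_closure_of
    proof (intro conjI allI impI)
      fix W assume W: "k \<in> W \<and> openin S W"
      then have "openin S (U \<inter> W)" "k \<in> U \<inter> W" using UV by auto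
      with kl(1) show "\<exists>y. y \<in> h ` A \<and> y \<in> W"
        unfolding C_def in_closure_of A_def by blast
    qed fact
    then have "A \<in> e l" using kl(3) by (auto simp: e_def A_def)
    then have "l \<in> S closure_of (h ` A)" by (simp add: e_def)
    then obtain y where "y \<in> h ` A" "y \<in> V"
      using UV unfolding in_closure_of by blast
    then show False using UV(5) by (auto simp: A_def disjnt_def)
  qed
  define g where "g = inv_into C e"
  define K' where "K' = \<lparr>carrier = e ` C, mult = (\<lambda>a b. e (g a \<otimes>\<^bsub>K\<^esub> g b)), one = e \<one>\<^bsub>K\<^esub>\<rparr>"
  define S' where "S' = pullback_topology (e ` C) g S"
  have tg: "topological_group K' S'"
    and hm: "homeomorphic_maps (subtopology S C) S' e g"
    using topological_group_transport[OF K(1) C e] by (simp_all add: g_def K'_def S'_def)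
  have hs: "subtopology S C homeomorphic_space S'"
    using hm by (auto simp: homeomorphic_space_def)
  have "closedin S C" by (simp add: C_def)
  then have "compact_space (subtopology S C)"
    using K(2) closedin_compact_space compact_space_subtopology by blast
  then have cS': "compact_space S'"
    using homeomorphic_compact_space[OF hs] by simp
  have "Hausdorff_space (subtopology S C)"
    using K(3) by (rule Hausdorff_space_subtopology)
  then have HS': "Hausdorff_space S'"
    using homeomorphic_Hausdorff_space[OF hs] by simp
  have ge: "g (e x) = x" if "x \<in> C" for x
    using that e by (simp add: g_def)
  have h': "e \<circ> h \<in> hom G K'"
    using h(1) by (auto simp: hom_def K'_def ge hC)
  have topT: "topspace T = carrier G" using G by (simp add: topological_group_def)
  have "continuous_map T (subtopology S C) h"
    using h(2) hC by (auto simp: continuous_map_in_subtopology topT)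
  then have ch': "continuous_map T S' (e \<circ> h)"
    by (rule continuous_map_compose) (use hm in \<open>simp add: homeomorphic_maps_def\<close>)
  have "openin (bohr_topology G T) {x \<in> topspace (bohr_topology G T). h x \<in> U}"
    if U: "openin S U" for U
  proof -
    have "openin (subtopology S C) (U \<inter> C)"
      using U by (auto simp: openin_subtopology)
    moreover have "continuous_map S' (subtopology S C) g"
      using hm by (simp add: homeomorphic_maps_def)
    ultimately have "openin S' {a \<in> topspace S'. g a \<in> U \<inter> C}"
      by (rule openin_continuous_map_preimage[rotated])
    from bohr_topology_basic[OF tg cS' HS' h' ch' this]
    have "openin (bohr_topology G T)
        {x \<in> carrier G. (e \<circ> h) x \<in> {a \<in> topspace S'. g a \<in> U \<inter> C}}" .
    moreover have "topspace S' = e ` C"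
      using tg by (simp add: topological_group_def K'_def)
    ultimately show ?thesis
      unfolding topspace_bohr_topology[OF G]
      by (smt (verit, ccfv_SIG) Collect_cong IntE IntI comp_apply ge hC image_eqI mem_Collect_eq)
  qed
  then show ?thesis
    unfolding continuous_map topspace_bohr_topology[OF G]
    using hK by (auto simp: top)
qed

theorem bohr_topology_smallest:
  fixes G :: "('a, 'm) monoid_scheme"
  assumes "topspace \<tau> = carrier G"
    and "\<And>(K :: 'a set set monoid) S h. \<lbrakk>topological_group K S; compact_space S; Hausdorff_space S;
           h \<in> hom G K; continuous_map T S h\<rbrakk> \<Longrightarrow> continuous_map \<tau> S h"
    and "openin (bohr_topology G T) U"
  shows "openin \<tau> U"
proof -
  have "generate_topology_on
     {{x \<in> carrier G. h x \<in> U} | h U. \<exists>(K :: 'a set set monoid) S.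
        topological_group K S \<and> compact_space S \<and> Hausdorff_space S \<and>
        h \<in> hom G K \<and> continuous_map T S h \<and> openin S U} U"
    using assms(3) unfolding bohr_topology_def by (rule openin_topology_generated_by)
  then show ?thesis
  proof induction
    case (Basis s)
    then obtain h V and K :: "'a set set monoid" and S where
      s: "s = {x \<in> carrier G. h x \<in> V}" "openin S V" and
      KS: "topological_group K S" "compact_space S" "Hausdorff_space S"
        "h \<in> hom G K" "continuous_map T S h"
      by blast
    show ?case
      using openin_continuous_map_preimage[OF assms(2)[OF KS] s(2)] by (simp add: s assms(1))
  qed auto
qed

end

theory Submission
  imports Defs
begin

text \<open>A compact group is recurrent: for every element \<open>k\<close> of it, powers \<open>k\<^sup>n\<close> with arbitrarily
  large \<open>n\<close> lie in any given neighbourhood of the identity. The Bohr topology inherits this from the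
  compact groups that define it (\<open>bohr_neighbourhood_contains_large_powers\<close>). In a linear space over
  \<open>\<real>\<close> or \<open>\<complex>\<close> this means that the multiples \<open>n \<cdot> x\<close>, which run off to infinity along the
  line through \<open>x\<close>, come back to every Bohr neighbourhood of \<open>0\<close>. Both claims follow.

  If \<open>\<lambda> \<mapsto> \<lambda> \<cdot> x\<close> were an embedding, the image of the unit ball would be the trace on the
  line of a Bohr neighbourhood of \<open>0\<close>, which contains some \<open>n \<cdot> x\<close> with \<open>n > 1\<close>.

  If the multiplication were jointly continuous at \<open>(0, 0)\<close>, then any neighbourhood \<open>U\<close> of \<open>0\<close>
  would contain \<open>\<lambda> \<cdot> v\<close> for all small \<open>\<lambda>\<close> and all \<open>v\<close> in some Bohr neighbourhood of \<open>0\<close>.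
  With \<open>\<lambda> = 1/n\<close> and \<open>v = n \<cdot> x\<close> for a large return time \<open>n\<close>, this gives \<open>x \<in> U\<close>, for every
  \<open>x\<close>, so the topology would not be Hausdorff.\<close>

lemma compact_space_cluster_point:
  assumes "compact_space S" "infinite A" "\<And>n. n \<in> A \<Longrightarrow> f n \<in> topspace S"
  obtains k where "k \<in> topspace S" "\<And>W. openin S W \<Longrightarrow> k \<in> W \<Longrightarrow> infinite {n \<in> A. f n \<in> W}"
proof (rule ccontr)
  assume "\<not> thesis"
  then have no: "\<exists>W. openin S W \<and> k \<in> W \<and> finite {n \<in> A. f n \<in> W}" if "k \<in> topspace S" for k
    using that \<open>\<And>k. \<lbrakk>k \<in> topspace S; \<And>W. \<lbrakk>openin S W; k \<in> W\<rbrakk> \<Longrightarrow> infinite {n \<in> A. f n \<in> W}\<rbrakk> \<Longrightarrow> thesis\<close>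
    by blast
  define \<U> where "\<U> = {W. openin S W \<and> finite {n \<in> A. f n \<in> W}}"
  have "\<forall>W\<in>\<U>. openin S W" "topspace S \<subseteq> \<Union>\<U>"
    using no unfolding \<U>_def by blast+
  then obtain \<F> where \<F>: "finite \<F>" "\<F> \<subseteq> \<U>" "topspace S \<subseteq> \<Union>\<F>"
    using assms(1) unfolding compact_space_alt by meson
  have "A \<subseteq> (\<Union>W\<in>\<F>. {n \<in> A. f n \<in> W})"
    using \<F>(3) assms(3) by blast
  moreover have "finite (\<Union>W\<in>\<F>. {n \<in> A. f n \<in> W})"
    using \<F>(1,2) unfolding \<U>_def by blast
  ultimately show False
    using assms(2) finite_subset by blast
qed

text \<open>The powers \<open>k\<^sup>n\<close> with \<open>n \<in> A\<close> accumulate at some point, and quotients of two powers close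
  to that point are close to the identity.\<close>

lemma compact_group_recurrence:
  fixes K :: "('k, 'm) monoid_scheme" and A :: "nat set"
  assumes K: "topological_group K S" "compact_space S"
    and U: "openin S U" "\<one>\<^bsub>K\<^esub> \<in> U" and k: "k \<in> carrier K" and A: "infinite A"
  obtains B where "infinite B" "B \<subseteq> A" "\<And>m n. \<lbrakk>m \<in> B; n \<in> B; m < n\<rbrakk> \<Longrightarrow> k [^]\<^bsub>K\<^esub> (n - m) \<in> U"
proof -
  interpret K: group K using K by (simp add: topological_group_def)
  have top: "topspace S = carrier K"
    and cm: "continuous_map (prod_topology S S) S (\<lambda>(x, y). x \<otimes>\<^bsub>K\<^esub> y)"
    and ci: "continuous_map S S (\<lambda>x. inv\<^bsub>K\<^esub> x)"
    using K by (auto simp: topological_group_def)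
  obtain c where c: "c \<in> carrier K"
    and cluster: "\<And>W. openin S W \<Longrightarrow> c \<in> W \<Longrightarrow> infinite {n \<in> A. k [^]\<^bsub>K\<^esub> n \<in> W}"
    using compact_space_cluster_point[OF K(2) A, of "\<lambda>n. k [^]\<^bsub>K\<^esub> n"] k top by auto
  have "continuous_map (prod_topology S S) S ((\<lambda>(x, y). x \<otimes>\<^bsub>K\<^esub> y) \<circ> (\<lambda>(x, y). (inv\<^bsub>K\<^esub> x, y)))"
    by (rule continuous_map_compose[OF _ cm])
      (use ci continuous_map_id[of S] in \<open>simp add: continuous_map_prod_top id_def\<close>)
  then have "openin (prod_topology S S) {p \<in> topspace (prod_topology S S).
      ((\<lambda>(x, y). x \<otimes>\<^bsub>K\<^esub> y) \<circ> (\<lambda>(x, y). (inv\<^bsub>K\<^esub> x, y))) p \<in> U}" (is "openin _ ?Q")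
    using U(1) openin_continuous_map_preimage by blast
  moreover have "(c, c) \<in> ?Q"
    using c U(2) by (simp add: top)
  ultimately obtain V W where VW: "openin S V" "openin S W" "c \<in> V" "c \<in> W" "V \<times> W \<subseteq> ?Q"
    unfolding openin_prod_topology_alt by meson
  define B where "B = {n \<in> A. k [^]\<^bsub>K\<^esub> n \<in> V \<inter> W}"
  show thesis
  proof
    show "infinite B"
      unfolding B_def using VW by (intro cluster) auto
    show "B \<subseteq> A" by (auto simp: B_def)
    fix m n assume mn: "m \<in> B" "n \<in> B" "m < n"
    then have "(k [^]\<^bsub>K\<^esub> m, k [^]\<^bsub>K\<^esub> n) \<in> ?Q"
      using VW(5) by (auto simp: B_def)
    then have "inv\<^bsub>K\<^esub> (k [^]\<^bsub>K\<^esub> m) \<otimes>\<^bsub>K\<^esub> k [^]\<^bsub>K\<^esub> n \<in> U"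
      by simp
    moreover have "k [^]\<^bsub>K\<^esub> n = k [^]\<^bsub>K\<^esub> m \<otimes>\<^bsub>K\<^esub> k [^]\<^bsub>K\<^esub> (n - m)"
      using mn k by (simp add: K.nat_pow_mult)
    ultimately show "k [^]\<^bsub>K\<^esub> (n - m) \<in> U"
      using k by (simp flip: K.m_assoc)
  qed
qed

text \<open>A Bohr neighbourhood is cut out by several homomorphisms at once. Having some return time
  \<open>n > 0\<close> is not preserved by intersecting neighbourhoods; the following property is, because the
  set obtained for the first neighbourhood can be refined for the second.\<close>

lemma bohr_topology_recurrence:
  fixes G :: "('a, 'm) monoid_scheme" and A :: "nat set"
  assumes G: "group G" and x: "x \<in> carrier G"
    and V: "openin (bohr_topology G T) V" "\<one>\<^bsub>G\<^esub> \<in> V" and A: "infinite A"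
  shows "\<exists>B. infinite B \<and> B \<subseteq> A \<and> (\<forall>m\<in>B. \<forall>n\<in>B. m < n \<longrightarrow> x [^]\<^bsub>G\<^esub> (n - m) \<in> V)"
proof -
  interpret G: group G by fact
  have "generate_topology_on
     {{x \<in> carrier G. h x \<in> U} | h U. \<exists>(K :: 'a set set monoid) S.
        topological_group K S \<and> compact_space S \<and> Hausdorff_space S \<and>
        h \<in> hom G K \<and> continuous_map T S h \<and> openin S U} V"
    using V(1) unfolding bohr_topology_def by (rule openin_topology_generated_by)
  then show ?thesis
    using V(2) A
  proof (induction arbitrary: A)
    case Empty
    then show ?case by simp
  next
    case (Int V1 V2)
    then obtain B1 where B1: "infinite B1" "B1 \<subseteq> A"
      "\<forall>m\<in>B1. \<forall>n\<in>B1. m < n \<longrightarrow> x [^]\<^bsub>G\<^esub> (n - m) \<in> V1"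
      by (meson IntD1)
    obtain B2 where "infinite B2" "B2 \<subseteq> B1"
      "\<forall>m\<in>B2. \<forall>n\<in>B2. m < n \<longrightarrow> x [^]\<^bsub>G\<^esub> (n - m) \<in> V2"
      using Int.IH(2)[of B1] Int.prems B1(1) by blast
    with B1 show ?case
      by (intro exI[of _ B2]) auto
  next
    case (UN \<V>)
    then obtain V' where V': "V' \<in> \<V>" "\<one>\<^bsub>G\<^esub> \<in> V'"
      by blast
    from UN.IH[OF this UN.prems(2)] obtain B where "infinite B" "B \<subseteq> A"
      "\<forall>m\<in>B. \<forall>n\<in>B. m < n \<longrightarrow> x [^]\<^bsub>G\<^esub> (n - m) \<in> V'"
      by blast
    with V'(1) show ?case
      by (intro exI[of _ B]) blast
  next
    case (Basis V)
    then obtain h U and K :: "'a set set monoid" and S where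
      V: "V = {x \<in> carrier G. h x \<in> U}" and U: "openin S U" and
      K: "topological_group K S" "compact_space S" and h: "h \<in> hom G K"
      by blast
    interpret h: group_hom G K h
      using h K(1) G by (simp add: group_hom_def group_hom_axioms_def topological_group_def)
    have "\<one>\<^bsub>K\<^esub> \<in> U"
      using Basis.prems(1) by (simp add: V)
    then obtain B where "infinite B" "B \<subseteq> A"
      "\<And>m n. \<lbrakk>m \<in> B; n \<in> B; m < n\<rbrakk> \<Longrightarrow> h x [^]\<^bsub>K\<^esub> (n - m) \<in> U"
      using compact_group_recurrence[OF K U _ h.hom_closed[OF x] Basis.prems(2)] by blast
    then show ?case
      using x by (intro exI[of _ B]) (simp add: V h.hom_nat_pow)
  qed
qed

corollary bohr_neighbourhood_contains_large_powers:
  fixes G :: "('a, 'm) monoid_scheme" and N :: nat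
  assumes "group G" "x \<in> carrier G" "openin (bohr_topology G T) V" "\<one>\<^bsub>G\<^esub> \<in> V"
  obtains n where "n > N" "x [^]\<^bsub>G\<^esub> n \<in> V"
proof -
  obtain B :: "nat set" where B: "infinite B"
    "\<forall>m\<in>B. \<forall>n\<in>B. m < n \<longrightarrow> x [^]\<^bsub>G\<^esub> (n - m) \<in> V"
    using bohr_topology_recurrence[OF assms infinite_UNIV_nat] by blast
  obtain m where m: "m \<in> B"
    using B(1) infinite_imp_nonempty by blast
  obtain n where "n \<in> B" "n > m + N"
    using B(1) unfolding infinite_nat_iff_unbounded by blast
  with B(2) m that[of "n - m"] show thesis by simp
qed

lemma nat_pow_additive_group:
  assumes "vector_space smul"
  shows "x [^]\<^bsub>additive_group\<^esub> (n::nat) = smul (of_nat n) x"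
proof -
  interpret vector_space smul by fact
  show ?thesis
  proof (induction n)
    case 0
    show ?case by (simp add: nat_pow_def additive_group_def)
  next
    case (Suc n)
    then show ?case
      by (simp add: nat_pow_def additive_group_def scale_left_distrib add.commute)
  qed
qed

lemma bohr_neighbourhood_contains_large_multiples:
  fixes smul :: "'f::field \<Rightarrow> 'a::ab_group_add \<Rightarrow> 'a" and N :: nat
  assumes "vector_space smul" "openin (bohr_topology additive_group T) V" "0 \<in> V"
  obtains n where "n > N" "smul (of_nat n) x \<in> V"
proof -
  have "group (additive_group :: 'a monoid)"
    using comm_group_additive_group by (rule comm_group.axioms)
  then obtain n where "n > N" "x [^]\<^bsub>additive_group\<^esub> n \<in> V"
    using bohr_neighbourhood_contains_large_powers[of additive_group x T V N] assms(2,3)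
    by (auto simp: additive_group_def)
  with that show thesis
    by (simp add: nat_pow_additive_group[OF assms(1)])
qed

lemma line_not_embedded_in_bohr_topology:
  fixes smul :: "'f::real_normed_field \<Rightarrow> 'a::ab_group_add \<Rightarrow> 'a"
  assumes "vector_space smul"
  shows "\<not> embedding_map euclidean (bohr_topology additive_group T) (\<lambda>c. smul c x)"
proof
  interpret vector_space smul by fact
  let ?B = "bohr_topology additive_group T" and ?L = "range (\<lambda>c. smul c x)"
  assume emb: "embedding_map euclidean ?B (\<lambda>c. smul c x)"
  then have inj: "inj (\<lambda>c. smul c x)"
    by (simp add: embedding_map_def homeomorphic_eq_everything_map)
  have "open_map euclidean (subtopology ?B ?L) (\<lambda>c. smul c x)"
    using emb by (simp add: embedding_map_def homeomorphic_imp_open_map)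
  then have "openin (subtopology ?B ?L) ((\<lambda>c. smul c x) ` ball 0 1)"
    unfolding open_map_def by (metis open_ball open_openin)
  then obtain V where V: "openin ?B V" "(\<lambda>c. smul c x) ` ball 0 1 = V \<inter> ?L"
    by (auto simp: openin_subtopology)
  have "smul 0 x \<in> (\<lambda>c. smul c x) ` ball 0 1"
    by (rule imageI) simp
  then have "0 \<in> V"
    using V(2) by auto
  then obtain n where n: "n > 1" "smul (of_nat n) x \<in> V"
    using bohr_neighbourhood_contains_large_multiples[OF assms V(1)] by blast
  then have "smul (of_nat n) x \<in> (\<lambda>c. smul c x) ` ball 0 1"
    using V(2) by blast
  then have "of_nat n \<in> (ball 0 1 :: 'f set)"
    using inj_image_mem_iff[OF inj] by blast
  with n(1) show False
    by simp
qed

lemma bohr_topology_not_topological_linear_space: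
  fixes smul :: "'f::{real_normed_field, topological_field} \<Rightarrow> 'a::ab_group_add \<Rightarrow> 'a"
    and x :: 'a
  assumes "topological_group additive_group T" and "x \<noteq> 0"
  shows "\<not> topological_linear_space smul (bohr_topology additive_group T)"
proof
  let ?B = "bohr_topology additive_group T"
  assume tls: "topological_linear_space smul ?B"
  then have vs: "vector_space smul" and "Hausdorff_space ?B"
    and cont: "continuous_map (prod_topology euclidean ?B) ?B (\<lambda>(c, v). smul c v)"
    by (auto simp: topological_linear_space_def)
  interpret vector_space smul by fact
  have top: "topspace ?B = UNIV"
    using topspace_bohr_topology[OF assms(1)] by (simp add: additive_group_def)
  obtain U where U: "openin ?B U" "0 \<in> U" "x \<notin> U"
    using \<open>Hausdorff_space ?B\<close> assms(2) unfolding Hausdorff_space_def top disjnt_iff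
    by (metis UNIV_I)
  let ?Q = "{p \<in> topspace (prod_topology euclidean ?B). (\<lambda>(c, v). smul c v) p \<in> U}"
  have "openin (prod_topology euclidean ?B) ?Q"
    using cont U(1) by (rule openin_continuous_map_preimage)
  moreover have "(0, 0) \<in> ?Q"
    using U(2) by (simp add: top)
  ultimately obtain D V where DV: "openin euclidean D" "openin ?B V" "0 \<in> D" "0 \<in> V" "D \<times> V \<subseteq> ?Q"
    unfolding openin_prod_topology_alt by meson
  then obtain e where e: "e > 0" "ball 0 e \<subseteq> D"
    using open_contains_ball open_openin by metis
  obtain N :: nat where N: "1 / e < real N"
    using reals_Archimedean2 by blast
  obtain n where n: "n > N" "smul (of_nat n) x \<in> V"
    using bohr_neighbourhood_contains_large_multiples[OF vs DV(2,4)] by blast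
  have "1 / e < real n"
    using N n(1) by linarith
  then have "1 / real n < e"
    using e(1) n(1) by (simp add: field_simps)
  then have "1 / of_nat n \<in> D"
    using e(2) by (auto simp: norm_divide)
  with n(2) DV(5) have "smul (1 / of_nat n) (smul (of_nat n) x) \<in> U"
    by auto
  then show False
    using n(1) U(3) by simp
qed

theorem corollary4p5:
  fixes smulR :: "real \<Rightarrow> 'a::ab_group_add \<Rightarrow> 'a"
    and smulC :: "complex \<Rightarrow> 'a \<Rightarrow> 'a"
    and T :: "'a topology"
  assumes nontrivial: "(UNIV :: 'a set) \<noteq> {0}"
  shows "(semitopological_linear_space smulR T \<longrightarrow>
            \<not> topological_linear_space smulR (bohr_topology additive_group T) \<and>
            (\<forall>x. \<not> embedding_map euclidean (bohr_topology additive_group T) (\<lambda>c. smulR c x))) \<and>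
         (semitopological_linear_space smulC T \<longrightarrow>
            \<not> topological_linear_space smulC (bohr_topology additive_group T) \<and>
            (\<forall>x. \<not> embedding_map euclidean (bohr_topology additive_group T) (\<lambda>c. smulC c x)))"
proof -
  obtain x :: 'a where "x \<noteq> 0"
    using nontrivial by blast
  then show ?thesis
    by (simp add: semitopological_linear_space_def line_not_embedded_in_bohr_topology
        bohr_topology_not_topological_linear_space)
qed

end
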